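(* Let $x_*\in X$ be an optimal solution of $\min_{x\in X}F(x)$. Suppose that near $x_*$ the bounds on $H_x$ and $g$ stated in the context hold with constants $\kappa_1,\kappa_2\in\mathbb R$ satisfying $\kappa_1+\kappa_2>0$, and that $f'$ is semi-smooth at $x_*$ with respect to $H_x$, i.e. $$\|f'(x_* )-f'(x)-H_x(x_*-x)\|_{X^*}=o(\|x-x_*\|_X)\quad\text{as } x\to x_*.$$ Let $(x_k)$ be iterates with $x_{k+1}=x_k+\Delta s_k(\omega_k)$, where $\omega_k\ge 0$, $\eta_k\ge 0$, and the inexact step $\Delta s_k(\omega_k)\in X$ satisfies $$\|\Delta x_k(\omega_k)-\Delta s_k(\omega_k)\|_X\le\eta_k\|\Delta x_k(\omega_k)\|_X ,$$ with $\Delta x_k(\omega_k)$ the exact step at $x_k$ defined in the context. Then: (a) The sequence of iterates locally converges linearly to $x_*$ if $\omega_k$ and $\eta_k$ are sufficiently small, namely if there exist a constant $0<\Theta<1$ and $k_0\in\mathbb N$ such that for all $k\ge k_0$ $$\frac{1}{\omega_k+\kappa_1+\kappa_2}\Big[\big(\omega_k+\|H_{x_k}\|_{\mathcal L(X,X^* )}+\kappa_2\big)\eta_k+\omega_k\Big]<\Theta .$$ (b) The sequence of iterates locally converges superlinearly to $x_*$ if both $\omega_k\to 0$ and $\eta_k\to 0$.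
   Context: $(X,\langle\cdot,\cdot\rangle_X)$ is a real Hilbert space with norm $\|\cdot\|_X$ and dual $X^*$. $F=f+g$ with $f,g:X\to\mathbb R$. The function $f$ is continuously differentiable and $f':X\to X^*$ is Lipschitz with constant $L_f>0$. The function $g$ is lower semi-continuous and there is $\kappa_2\in\mathbb R$ with $$g(sx+(1-s)y)\le s g(x)+(1-s)g(y)-\tfrac{\kappa_2}{2}s(1-s)\|x-y\|_X^2\quad\forall x,y\in X,\ s\in[0,1].$$ For each $x\in X$, $H_x\in\mathcal L(X,X^* )$ is a bounded linear operator identified with a symmetric bilinear form, $H_x(v,w)=(H_xv)(w)$. The lower bound on $H_x$ is $H_x(v,v)\ge\kappa_1\|v\|_X^2$ for all $v\in X$ (here assumed with the constant $\kappa_1$ for $x$ near $x_*$). Along the iterates there is a uniform bound $\|H_{x_k}\|_{\mathcal L(X,X^* )}\le M$ for some $M>0$. For $x\in X$ and $\omega>-(\kappa_1+\kappa_2)$ the exact step is $$\Delta x(\omega)=\operatorname*{argmin}_{\delta x\in X}\lambda_{x,\omega}(\delta x),\qquad \lambda_{x,\omega}(\delta x)=f'(x)\delta x+\tfrac12H_x(\delta x,\delta x)+\tfrac\omega2\|\delta x\|_X^2+g(x+\delta x)-g(x),$$ and $\Delta x_k(\omega_k)$ denotes this step for $x=x_k$, $\omega=\omega_k$. "Locally converges linearly" means: there is a neighborhood $U$ of $x_*$ and an index $k_1$ such that, if $x_{k}\in U$ for some $k\ge k_1$, then $x_j\to x_*$ and there is $q\in(0,1)$ with $\|x_{j+1}-x_*\|_X\le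 q\|x_j-x_*\|_X$ for all $j\ge k$. "Locally converges superlinearly" means: there is a neighborhood $U$ of $x_*$ and an index $k_1$ such that, if $x_k\in U$ for some $k\ge k_1$, then $x_j\to x_*$ and $\|x_{j+1}-x_*\|_X=o(\|x_j-x_*\|_X)$ as $j\to\infty$. *)

theory Defs
  imports "HOL-Analysis.Analysis" "HOL-Library.Landau_Symbols"
begin

text \<open>The dual of \<open>X\<close> is \<open>'a \<Rightarrow>\<^sub>L real\<close> and the operators from \<open>X\<close> to its dual are
  \<open>'a \<Rightarrow>\<^sub>L ('a \<Rightarrow>\<^sub>L real)\<close>, both with the operator norm; \<open>H x\<close> is read as the bilinear form
  sending \<open>v\<close>, \<open>w\<close> to \<open>blinfun_apply (blinfun_apply (H x) v) w\<close>.\<close>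

definition lower_semicontinuous :: "('a::topological_space \<Rightarrow> real) \<Rightarrow> bool" where
  "lower_semicontinuous g \<longleftrightarrow> (\<forall>x. \<forall>c < g x. \<forall>\<^sub>F y in nhds x. c < g y)"

text \<open>For \<open>\<kappa> < 0\<close> this allows a bounded amount of nonconvexity.\<close>

definition convex_with_modulus :: "real \<Rightarrow> ('a::real_normed_vector \<Rightarrow> real) \<Rightarrow> bool" where
  "convex_with_modulus \<kappa> g \<longleftrightarrow>
     (\<forall>x y. \<forall>s\<in>{0..1}.
        g (s *\<^sub>R x + (1 - s) *\<^sub>R y)
          \<le> s * g x + (1 - s) * g y - \<kappa> / 2 * s * (1 - s) * (norm (x - y))\<^sup>2)"

definition semismooth_at ::
  "('a::real_normed_vector \<Rightarrow> 'a \<Rightarrow>\<^sub>L real) \<Rightarrow> ('a \<Rightarrow> 'a \<Rightarrow>\<^sub>L ('a \<Rightarrow>\<^sub>L real)) \<Rightarrow> 'a \<Rightarrow> bool" where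
  "semismooth_at f' H xs \<longleftrightarrow>
     (\<lambda>x. norm (f' xs - f' x - blinfun_apply (H x) (xs - x))) \<in> o[at xs](\<lambda>x. norm (x - xs))"

definition step_model ::
  "('a::real_normed_vector \<Rightarrow> 'a \<Rightarrow>\<^sub>L real) \<Rightarrow> ('a \<Rightarrow> 'a \<Rightarrow>\<^sub>L ('a \<Rightarrow>\<^sub>L real)) \<Rightarrow> ('a \<Rightarrow> real)
     \<Rightarrow> 'a \<Rightarrow> real \<Rightarrow> 'a \<Rightarrow> real" where
  "step_model f' H g x \<omega> d =
     blinfun_apply (f' x) d + 1 / 2 * blinfun_apply (blinfun_apply (H x) d) d
     + \<omega> / 2 * (norm d)\<^sup>2 + g (x + d) - g x"

text \<open>If \<open>H x\<close> is bounded below by \<open>\<kappa>\<^sub>1\<close>, \<open>g\<close> is lower semicontinuous and convex with modulus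
  \<open>\<kappa>\<^sub>2\<close>, and \<open>\<omega> > - (\<kappa>\<^sub>1 + \<kappa>\<^sub>2)\<close>, the model is strongly convex on a Hilbert space and has exactly
  one minimizer. Where no minimizer exists, the value is unspecified.\<close>

definition exact_step ::
  "('a::real_normed_vector \<Rightarrow> 'a \<Rightarrow>\<^sub>L real) \<Rightarrow> ('a \<Rightarrow> 'a \<Rightarrow>\<^sub>L ('a \<Rightarrow>\<^sub>L real)) \<Rightarrow> ('a \<Rightarrow> real)
     \<Rightarrow> 'a \<Rightarrow> real \<Rightarrow> 'a" where
  "exact_step f' H g x \<omega> = arg_min (step_model f' H g x \<omega>) (\<lambda>_. True)"

definition locally_converges_linearly ::
  "(nat \<Rightarrow> 'a::real_normed_vector) \<Rightarrow> 'a \<Rightarrow> bool" where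
  "locally_converges_linearly x xs \<longleftrightarrow>
     (\<exists>U k1. open U \<and> xs \<in> U \<and>
        (\<forall>k\<ge>k1. x k \<in> U \<longrightarrow>
           x \<longlonglongrightarrow> xs \<and>
           (\<exists>q. 0 < q \<and> q < 1 \<and>
              (\<forall>j\<ge>k. norm (x (Suc j) - xs) \<le> q * norm (x j - xs)))))"

definition locally_converges_superlinearly ::
  "(nat \<Rightarrow> 'a::real_normed_vector) \<Rightarrow> 'a \<Rightarrow> bool" where
  "locally_converges_superlinearly x xs \<longleftrightarrow>
     (\<exists>U k1. open U \<and> xs \<in> U \<and>
        (\<forall>k\<ge>k1. x k \<in> U \<longrightarrow>
           x \<longlonglongrightarrow> xs \<and>
           (\<lambda>j. norm (x (Suc j) - xs)) \<in> o(\<lambda>j. norm (x j - xs))))"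

end

theory Submission
  imports Defs
begin

text \<open>Write \<open>v = xs - y\<close>, \<open>e = y + d - xs\<close> for the exact step \<open>d\<close> at \<open>y\<close>, \<open>r\<close> for the semismoothness
  residual at \<open>y\<close>, and \<open>\<kappa> = \<kappa>\<^sub>1 + \<kappa>\<^sub>2\<close>. Both \<open>xs\<close> (for \<open>f + g\<close>) and \<open>y + d\<close> (for the model) are
  minimizers; adding their variational inequalities, each tested with the other point, gives
  \<open>\<kappa> * (norm e)\<^sup>2 + \<omega> * (d \<bullet> e) \<le> norm r * norm e\<close>. Since \<open>d = v + e\<close>, this bounds \<open>norm e\<close> by
  \<open>\<omega> / (\<omega> + \<kappa>) * norm v\<close> and \<open>norm d\<close> by \<open>norm v\<close>, up to \<open>norm r / \<kappa> = o(norm v)\<close>. An inexact step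
  thus contracts the error by the factor \<open>\<omega> / (\<omega> + \<kappa>) + \<eta>\<close> up to \<open>o(1)\<close>, and this factor is at most the
  quantity bounded by \<open>\<Theta>\<close>, as the norm of \<open>H\<close> is at least \<open>\<kappa>\<^sub>1\<close>.\<close>

section \<open>Existence of minimizers under strong convexity\<close>

lemma lower_semicontinuous_add_translation:
  fixes g :: "'a::real_normed_vector \<Rightarrow> real"
  assumes g: "lower_semicontinuous g" and c: "continuous_on UNIV c"
  shows "lower_semicontinuous (\<lambda>d. c d + g (a + d))"
  unfolding lower_semicontinuous_def
proof (intro allI impI)
  fix d t assume t: "t < c d + g (a + d)"
  define e where "e = (c d + g (a + d) - t) / 2"
  have e: "e > 0" using t by (simp add: e_def)
  have "isCont c d" using c by (simp add: continuous_on_eq_continuous_at)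
  then have "(c \<longlongrightarrow> c d) (nhds d)"
    by (simp add: continuous_within tendsto_at_iff_tendsto_nhds)
  then have 1: "\<forall>\<^sub>F p in nhds d. c d - e < c p"
    using e by (auto dest: order_tendstoD(1)[where a = "c d - e"])
  have lim: "filterlim (\<lambda>p. a + p) (nhds (a + d)) (nhds d)"
    by (intro tendsto_intros filterlim_ident)
  have "\<forall>\<^sub>F q in nhds (a + d). g (a + d) - e < g q"
    using g e by (simp add: lower_semicontinuous_def)
  then have 2: "\<forall>\<^sub>F p in nhds d. g (a + d) - e < g (a + p)"
    using lim by (rule eventually_compose_filterlim)
  show "\<forall>\<^sub>F p in nhds d. t < c p + g (a + p)"
    using 1 2 by eventually_elim (simp add: e_def field_simps)
qed

lemma convex_with_modulusD:
  assumes "convex_with_modulus \<kappa> g" "0 \<le> s" "s \<le> 1"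
  shows "g (s *\<^sub>R x + (1 - s) *\<^sub>R y)
          \<le> s * g x + (1 - s) * g y - \<kappa> / 2 * s * (1 - s) * (norm (x - y))\<^sup>2"
  using assms unfolding convex_with_modulus_def by auto

text \<open>Lower semicontinuity bounds the function below on a small ball around the origin; strong
  convexity along rays extends the bound, with a quadratic gain that beats the linear loss.\<close>

lemma strongly_convex_lsc_bdd_below:
  fixes \<phi> :: "'a::real_normed_vector \<Rightarrow> real"
  assumes lsc: "lower_semicontinuous \<phi>" and conv: "convex_with_modulus \<kappa> \<phi>" and \<kappa>: "\<kappa> > 0"
  shows "bdd_below (range \<phi>)"
proof -
  have "\<forall>\<^sub>F y in nhds 0. \<phi> 0 - 1 < \<phi> y"
    using lsc by (simp add: lower_semicontinuous_def)
  then obtain r0 where r0: "r0 > 0" "\<And>y. norm y < r0 \<Longrightarrow> \<phi> 0 - 1 < \<phi> y"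
    by (auto simp: eventually_nhds_metric)
  define r where "r = r0 / 2"
  have r: "r > 0" "\<And>y. norm y \<le> r \<Longrightarrow> \<phi> 0 - 1 < \<phi> y"
    using r0 by (auto simp: r_def)
  \<comment> \<open>After division by \<open>s\<close>, the terms linear in \<open>n\<close> are
    \<open>n / r\<close>, from \<open>1 / s\<close>, and \<open>\<kappa> / 2 * r * n\<close>, from
    \<open>(1 - s) * n\<^sup>2\<close>; \<open>b\<close> is their total coefficient.\<close>
  define b where "b = 1 / r + \<kappa> / 2 * r"
  have b: "b > 0" using r \<kappa> by (simp add: b_def add_pos_pos)
  \<comment> \<open>\<open>b\<^sup>2 / (2 * \<kappa>)\<close> is the maximum of
    \<open>b * n - \<kappa> / 2 * n\<^sup>2\<close> over \<open>n\<close>, found below by completing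
    the square.\<close>
  have "\<phi> 0 - 1 - b\<^sup>2 / (2 * \<kappa>) \<le> \<phi> y" for y
  proof (cases "norm y \<le> r")
    case True
    have "b\<^sup>2 / (2 * \<kappa>) \<ge> 0" using \<kappa> by simp
    then show ?thesis using r(2)[OF True] by linarith
  next
    case False
    define n where "n = norm y"
    have n: "n > r" "n > 0" using False r by (auto simp: n_def)
    \<comment> \<open>Scales \<open>y\<close> back to the sphere of radius \<open>r\<close>, where
      the local lower bound is available.\<close>
    define s where "s = r / n"
    have s: "0 < s" "s \<le> 1" using n r by (auto simp: s_def)
    have "norm (s *\<^sub>R y) = r" using n r by (simp add: s_def n_def)
    then have "\<phi> 0 - 1 < \<phi> (s *\<^sub>R y)" using r(2) by simp
    also have "\<dots> \<le> s * \<phi> y + (1 - s) * \<phi> 0 - \<kappa> / 2 * s * (1 - s) * n\<^sup>2"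
      using convex_with_modulusD[OF conv, of s y 0] s by (simp add: n_def)
    finally have "s * (\<phi> 0 - \<phi> y + \<kappa> / 2 * (1 - s) * n\<^sup>2) < 1"
      by (simp add: algebra_simps)
    then have "\<phi> 0 - \<phi> y + \<kappa> / 2 * (1 - s) * n\<^sup>2 < 1 / s"
      using s by (simp add: field_simps)
    moreover have "(1 - s) * n\<^sup>2 = n\<^sup>2 - r * n"
      using n by (simp add: s_def power2_eq_square field_simps)
    moreover have "1 / s = n / r" by (simp add: s_def)
    ultimately have "\<phi> 0 - \<phi> y + \<kappa> / 2 * (n\<^sup>2 - r * n) < n / r"
      by (metis mult.assoc)
    then have "\<phi> 0 - \<phi> y < b * n - \<kappa> / 2 * n\<^sup>2"
      by (simp add: b_def algebra_simps)
    also have "\<dots> = b\<^sup>2 / (2 * \<kappa>) - (\<kappa> * n - b)\<^sup>2 / (2 * \<kappa>)"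
      using \<kappa> by (simp add: field_simps power2_eq_square)
    also have "\<dots> \<le> b\<^sup>2 / (2 * \<kappa>)" using \<kappa> by simp
    finally show ?thesis by simp
  qed
  then show ?thesis by (auto simp: bdd_below_def)
qed

text \<open>The midpoint inequality turns near-minimality into closeness, so a minimizing sequence
  is Cauchy. Completeness supplies a limit in norm, and lower semicontinuity keeps the value there
  at the infimum.\<close>

lemma strongly_convex_lsc_attains_min:
  fixes \<phi> :: "'a::{real_normed_vector,complete_space} \<Rightarrow> real"
  assumes lsc: "lower_semicontinuous \<phi>" and conv: "convex_with_modulus \<kappa> \<phi>" and \<kappa>: "\<kappa> > 0"
  shows "\<exists>d. is_arg_min \<phi> (\<lambda>_. True) d"
proof -
  define m where "m = Inf (range \<phi>)"
  have bdd: "bdd_below (range \<phi>)"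
    using strongly_convex_lsc_bdd_below[OF assms] .
  have m: "m \<le> \<phi> y" for y
    unfolding m_def using bdd by (simp add: cInf_lower)
  have "\<exists>y. \<phi> y < m + 1 / real (Suc n)" for n
    using cInf_lessD[of "range \<phi>" "m + 1 / real (Suc n)"] by (auto simp: m_def)
  then obtain Y where Y: "\<And>n. \<phi> (Y n) < m + 1 / real (Suc n)" by metis
  \<comment> \<open>Convexity with \<open>s = 1/2\<close> produces
    \<open>\<kappa> / 2 * (1/4)\<close>, and the value at the midpoint is at least
    \<open>m\<close>.\<close>
  have gap: "\<kappa> / 8 * (norm (a - b))\<^sup>2 \<le> (\<phi> a + \<phi> b) / 2 - m" for a b
    using convex_with_modulusD[OF conv, of "1/2" a b] m[of "(1/2) *\<^sub>R a + (1 - 1/2) *\<^sub>R b"]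
    by (simp add: field_simps)
  have "Cauchy Y"
  proof (rule metric_CauchyI)
    fix e :: real assume e: "e > 0"
    \<comment> \<open>By \<open>gap\<close>, two points whose values exceed \<open>m\<close> by less
      than \<open>\<kappa> / 8 * e\<^sup>2\<close> are closer than \<open>e\<close>.\<close>
    obtain N where N: "1 / real (Suc N) < \<kappa> / 8 * e\<^sup>2"
      using reals_Archimedean[of "\<kappa> / 8 * e\<^sup>2"] e \<kappa> by (auto simp: inverse_eq_divide)
    have small: "\<phi> (Y n) < m + \<kappa> / 8 * e\<^sup>2" if "n \<ge> N" for n
    proof -
      have "1 / real (Suc n) \<le> 1 / real (Suc N)" using that by (simp add: frac_le)
      then show ?thesis using Y[of n] N by linarith
    qed
    have "dist (Y i) (Y j) < e" if "i \<ge> N" "j \<ge> N" for i j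
    proof -
      note gap[of "Y i" "Y j"]
      also have "(\<phi> (Y i) + \<phi> (Y j)) / 2 - m < \<kappa> / 8 * e\<^sup>2"
        using small[OF that(1)] small[OF that(2)] by (simp add: field_simps)
      finally have "\<kappa> / 8 * (norm (Y i - Y j))\<^sup>2 < \<kappa> / 8 * e\<^sup>2" .
      then have "(norm (Y i - Y j))\<^sup>2 < e\<^sup>2" using \<kappa> by simp
      then show ?thesis using e by (simp add: dist_norm power_less_imp_less_base)
    qed
    then show "\<exists>N. \<forall>i\<ge>N. \<forall>j\<ge>N. dist (Y i) (Y j) < e" by blast
  qed
  then obtain d where d: "Y \<longlonglongrightarrow> d"
    by (auto simp: Cauchy_convergent_iff convergent_def)
  have lim: "(\<lambda>n. m + 1 / real (Suc n)) \<longlonglongrightarrow> m + 0"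
    using LIMSEQ_inverse_real_of_nat by (intro tendsto_intros) (simp add: inverse_eq_divide)
  have "\<phi> d \<le> m"
  proof (rule ccontr)
    assume "\<not> \<phi> d \<le> m"
    then obtain c where c: "m < c" "c < \<phi> d" using dense by (metis not_le)
    have "\<forall>\<^sub>F y in nhds d. c < \<phi> y" using lsc c by (simp add: lower_semicontinuous_def)
    then have "\<forall>\<^sub>F n in sequentially. c < \<phi> (Y n)"
      using d by (rule eventually_compose_filterlim)
    moreover have "\<forall>\<^sub>F n in sequentially. m + 1 / real (Suc n) < c"
      using lim c by (auto dest: order_tendstoD(2)[where a = c])
    ultimately have "\<forall>\<^sub>F n in sequentially. False"
      by eventually_elim (use Y in \<open>meson less_asym less_trans\<close>)
    then show False by simp
  qed
  then have "is_arg_min \<phi> (\<lambda>_. True) d"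
    using m by (auto simp: is_arg_min_def not_less intro: order_trans)
  then show ?thesis by blast
qed

section \<open>First-order optimality\<close>

text \<open>Move from \<open>u\<close> a fraction \<open>t\<close> towards \<open>z\<close>, divide
  by \<open>t\<close> and let \<open>t\<close> tend to 0. Only \<open>\<phi>\<close> is
  differentiated; \<open>g\<close> enters through its convexity inequality, which stands in for a
  subdifferential and serves for either sign of \<open>\<kappa>\<close>.\<close>

lemma minimizer_variational_inequality:
  fixes g \<phi> :: "'a::real_normed_vector \<Rightarrow> real"
  assumes conv: "convex_with_modulus \<kappa> g"
    and deriv: "(\<phi> has_derivative D) (at u)"
    and min: "\<And>z. \<phi> u + g u \<le> \<phi> z + g z"
  shows "\<kappa> / 2 * (norm (z - u))\<^sup>2 \<le> D (z - u) + g z - g u"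
proof -
  define h where "h = z - u"
  define \<psi> where "\<psi> = (\<lambda>t. \<phi> (u + t *\<^sub>R h))"
  have "((\<lambda>t. u + t *\<^sub>R h) has_derivative (\<lambda>t. t *\<^sub>R h)) (at 0)"
    by (auto intro!: derivative_eq_intros)
  moreover have "(\<phi> has_derivative D) (at (u + 0 *\<^sub>R h))" using deriv by simp
  ultimately have "(\<psi> has_derivative (\<lambda>t. D (t *\<^sub>R h))) (at 0)"
    unfolding \<psi>_def by (rule has_derivative_compose)
  moreover have "(\<lambda>t. D (t *\<^sub>R h)) = (\<lambda>t. D h * t)"
    using has_derivative_linear[OF deriv] by (auto simp: linear_cmul)
  ultimately have "(\<psi> has_field_derivative D h) (at 0)"
    by (simp add: has_field_derivative_def)
  \<comment> \<open>The limit is one-sided because convexity of \<open>g\<close> only controls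
    points between \<open>u\<close> and \<open>z\<close>.\<close>
  then have "((\<lambda>t. (\<psi> t - \<psi> 0) / t) \<longlongrightarrow> D h) (at_right 0)"
    by (auto simp: DERIV_def intro: filterlim_at_split[THEN iffD1, THEN conjunct2])
  moreover have "((\<lambda>t. g u - g z + \<kappa> / 2 * (1 - t) * (norm h)\<^sup>2)
      \<longlongrightarrow> g u - g z + \<kappa> / 2 * (1 - 0) * (norm h)\<^sup>2) (at_right 0)"
    by (intro tendsto_intros)
  moreover have "\<forall>\<^sub>F t in at_right 0. g u - g z + \<kappa> / 2 * (1 - t) * (norm h)\<^sup>2 \<le> (\<psi> t - \<psi> 0) / t"
  proof -
    have "g u - g z + \<kappa> / 2 * (1 - t) * (norm h)\<^sup>2 \<le> (\<psi> t - \<psi> 0) / t" if t: "0 < t" "t < 1" for t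
    proof -
      have "t *\<^sub>R z + (1 - t) *\<^sub>R u = u + t *\<^sub>R h" by (simp add: h_def algebra_simps)
      then have "g (u + t *\<^sub>R h) \<le> t * g z + (1 - t) * g u - \<kappa> / 2 * t * (1 - t) * (norm h)\<^sup>2"
        using convex_with_modulusD[OF conv, of t z u] t by (simp add: h_def)
      moreover have "\<psi> 0 + g u \<le> \<psi> t + g (u + t *\<^sub>R h)" using min by (simp add: \<psi>_def)
      ultimately have "t * (g u - g z + \<kappa> / 2 * (1 - t) * (norm h)\<^sup>2) \<le> \<psi> t - \<psi> 0"
        by (simp add: algebra_simps)
      then show ?thesis using t by (simp add: pos_le_divide_eq mult.commute)
    qed
    then show ?thesis unfolding eventually_at_right_field by (intro exI[of _ 1]) auto
  qed
  ultimately have "g u - g z + \<kappa> / 2 * (1 - 0) * (norm h)\<^sup>2 \<le> D h"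
    by (intro tendsto_le[OF trivial_limit_at_right_real])
  then show ?thesis by (simp add: h_def)
qed

section \<open>The regularized model and its minimizer\<close>

text \<open>Moduli add: the linear term contributes none, the squared norm exactly
  \<open>\<omega>\<close>, the form \<open>H y\<close> at least \<open>\<kappa>\<^sub>1\<close>, and
  \<open>g\<close> gives \<open>\<kappa>\<^sub>2\<close>. Single moduli may be negative.\<close>

lemma step_model_strongly_convex:
  fixes f' :: "'a::real_inner \<Rightarrow> 'a \<Rightarrow>\<^sub>L real"
  assumes g: "convex_with_modulus \<kappa>\<^sub>2 g"
    and sym: "\<And>v w. blinfun_apply (blinfun_apply (H y) v) w = blinfun_apply (blinfun_apply (H y) w) v"
    and lower: "\<And>v. \<kappa>\<^sub>1 * (norm v)\<^sup>2 \<le> blinfun_apply (blinfun_apply (H y) v) v"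
  shows "convex_with_modulus (\<omega> + \<kappa>\<^sub>1 + \<kappa>\<^sub>2) (step_model f' H g y \<omega>)"
  unfolding convex_with_modulus_def
proof (intro allI ballI)
  fix a b :: 'a and s :: real assume "s \<in> {0..1}"
  then have s: "0 \<le> s" "s \<le> 1" by auto
  define B where "B = (\<lambda>v w. blinfun_apply (blinfun_apply (H y) v) w)"
  define p where "p = s *\<^sub>R a + (1 - s) *\<^sub>R b"
  have "y + p = s *\<^sub>R (y + a) + (1 - s) *\<^sub>R (y + b)" by (simp add: p_def algebra_simps)
  then have gp: "g (y + p) \<le> s * g (y + a) + (1 - s) * g (y + b)
      - \<kappa>\<^sub>2 / 2 * s * (1 - s) * (norm (a - b))\<^sup>2"
    using convex_with_modulusD[OF g s, of "y + a" "y + b"] by simp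
  \<comment> \<open>Symmetry merges the two mixed terms, so \<open>B\<close> obeys the same identity
    as the squared norm in \<open>np\<close>.\<close>
  have Bp: "B p p = s * B a a + (1 - s) * B b b - s * (1 - s) * B (a - b) (a - b)"
    using sym[of a b] unfolding B_def p_def
    by (simp add: blinfun.bilinear_simps algebra_simps)
  have np: "(norm p)\<^sup>2 = s * (norm a)\<^sup>2 + (1 - s) * (norm b)\<^sup>2 - s * (1 - s) * (norm (a - b))\<^sup>2"
    unfolding p_def power2_norm_eq_inner
    by (simp add: inner_simps inner_commute algebra_simps)
  have fp: "f' y p = s * f' y a + (1 - s) * f' y b"
    by (simp add: p_def blinfun.bilinear_simps)
  have "s * (1 - s) * (\<kappa>\<^sub>1 * (norm (a - b))\<^sup>2) \<le> s * (1 - s) * B (a - b) (a - b)"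
    using lower s unfolding B_def by (intro mult_left_mono) auto
  then have Bp': "B p p \<le> s * B a a + (1 - s) * B b b - s * (1 - s) * (\<kappa>\<^sub>1 * (norm (a - b))\<^sup>2)"
    using Bp by linarith
  show "step_model f' H g y \<omega> (s *\<^sub>R a + (1 - s) *\<^sub>R b)
      \<le> s * step_model f' H g y \<omega> a + (1 - s) * step_model f' H g y \<omega> b
        - (\<omega> + \<kappa>\<^sub>1 + \<kappa>\<^sub>2) / 2 * s * (1 - s) * (norm (a - b))\<^sup>2"
    using gp Bp'[unfolded B_def] unfolding p_def[symmetric] step_model_def fp np
    by (simp add: field_simps)
qed

text \<open>\<open>exact_step\<close> is the value of a choice operator, so its minimizing property
  rests on the existence of some minimizer.\<close>

lemma exact_step_minimizes:
  fixes f' :: "'a::{real_inner,complete_space} \<Rightarrow> 'a \<Rightarrow>\<^sub>L real"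
  assumes g_lsc: "lower_semicontinuous g" and g: "convex_with_modulus \<kappa>\<^sub>2 g"
    and sym: "\<And>v w. blinfun_apply (blinfun_apply (H y) v) w = blinfun_apply (blinfun_apply (H y) w) v"
    and lower: "\<And>v. \<kappa>\<^sub>1 * (norm v)\<^sup>2 \<le> blinfun_apply (blinfun_apply (H y) v) v"
    and pos: "\<omega> + \<kappa>\<^sub>1 + \<kappa>\<^sub>2 > 0"
  shows "step_model f' H g y \<omega> (exact_step f' H g y \<omega>) \<le> step_model f' H g y \<omega> d"
proof -
  have "continuous_on UNIV (\<lambda>d. blinfun_apply (f' y) d
      + 1 / 2 * blinfun_apply (blinfun_apply (H y) d) d + \<omega> / 2 * (norm d)\<^sup>2 - g y)"
    by (intro continuous_intros)
  from lower_semicontinuous_add_translation[OF g_lsc this, of y]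
  have "lower_semicontinuous (step_model f' H g y \<omega>)"
    by (simp add: step_model_def[abs_def] algebra_simps)
  then have "\<exists>d. is_arg_min (step_model f' H g y \<omega>) (\<lambda>_. True) d"
    using strongly_convex_lsc_attains_min[OF _ step_model_strongly_convex[where H = H and g = g] pos]
      g sym lower by blast
  then have "is_arg_min (step_model f' H g y \<omega>) (\<lambda>_. True) (exact_step f' H g y \<omega>)"
    unfolding exact_step_def arg_min_def by (rule someI_ex)
  then show ?thesis by (simp add: is_arg_min_def not_less)
qed

section \<open>Error estimate for one step\<close>

text \<open>The residual stays explicit and is not assumed small, so one inequality serves both
  rates. It enters once through the error of the exact step and \<open>\<eta>\<close> times through
  the length of that step, hence the factor \<open>1 + \<eta>\<close>.\<close>

lemma inexact_step_estimate:
  fixes f g :: "'a::{real_inner,complete_space} \<Rightarrow> real"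
  assumes deriv: "(f has_derivative blinfun_apply (f' xs)) (at xs)"
    and g_lsc: "lower_semicontinuous g" and g: "convex_with_modulus \<kappa>\<^sub>2 g"
    and opt: "\<And>z. f xs + g xs \<le> f z + g z"
    and sym: "\<And>v w. blinfun_apply (blinfun_apply (H y) v) w = blinfun_apply (blinfun_apply (H y) w) v"
    and lower: "\<And>v. \<kappa>\<^sub>1 * (norm v)\<^sup>2 \<le> blinfun_apply (blinfun_apply (H y) v) v"
    and pos: "\<kappa>\<^sub>1 + \<kappa>\<^sub>2 > 0" and \<omega>: "\<omega> \<ge> 0" and \<eta>: "\<eta> \<ge> 0"
    and inexact: "norm (exact_step f' H g y \<omega> - s) \<le> \<eta> * norm (exact_step f' H g y \<omega>)"
  shows "norm (y + s - xs) \<le> (\<omega> / (\<omega> + \<kappa>\<^sub>1 + \<kappa>\<^sub>2) + \<eta>) * norm (y - xs)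
           + (1 + \<eta>) / (\<kappa>\<^sub>1 + \<kappa>\<^sub>2) * norm (f' xs - f' y - blinfun_apply (H y) (xs - y))"
proof -
  define d where "d = exact_step f' H g y \<omega>"
  define e where "e = y + d - xs"
  define v where "v = xs - y"
  define r where "r = f' xs - f' y - blinfun_apply (H y) v"
  define \<kappa> where "\<kappa> = \<kappa>\<^sub>1 + \<kappa>\<^sub>2"
  have \<kappa>: "\<kappa> > 0" using pos by (simp add: \<kappa>_def)
  have dve: "d = v + e" by (simp add: e_def v_def)

  \<comment> \<open>The smooth part of the model, written in the end point \<open>p = y + d\<close>
    instead of the displacement, so that it shares its argument with \<open>g\<close>. The constant
    \<open>- g y\<close> is dropped.\<close>
  define \<phi> where "\<phi> = (\<lambda>p. blinfun_apply (f' y) (p - y)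
      + 1 / 2 * blinfun_apply (blinfun_apply (H y) (p - y)) (p - y) + \<omega> / 2 * (norm (p - y))\<^sup>2)"
  have "(\<phi> has_derivative (\<lambda>h. blinfun_apply (f' y) h
      + blinfun_apply (blinfun_apply (H y) d) h + \<omega> * (d \<bullet> h))) (at (y + d))"
    unfolding \<phi>_def power2_norm_eq_inner
  proof (rule has_derivative_eq_rhs)
    show "((\<lambda>p. blinfun_apply (f' y) (p - y) + 1 / 2 * blinfun_apply (blinfun_apply (H y) (p - y)) (p - y)
        + \<omega> / 2 * ((p - y) \<bullet> (p - y))) has_derivative
      (\<lambda>h. blinfun_apply (f' y) h + 1 / 2 * (blinfun_apply (blinfun_apply (H y) d) h
        + blinfun_apply (blinfun_apply (H y) h) d) + \<omega> / 2 * (d \<bullet> h + h \<bullet> d))) (at (y + d))"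
      by (auto intro!: derivative_eq_intros)
    \<comment> \<open>The product rule yields two bilinear terms; symmetry makes them equal and
      absorbs the factor 1/2.\<close>
    show "(\<lambda>h. blinfun_apply (f' y) h + 1 / 2 * (blinfun_apply (blinfun_apply (H y) d) h
        + blinfun_apply (blinfun_apply (H y) h) d) + \<omega> / 2 * (d \<bullet> h + h \<bullet> d))
      = (\<lambda>h. blinfun_apply (f' y) h + blinfun_apply (blinfun_apply (H y) d) h + \<omega> * (d \<bullet> h))"
    proof
      fix h
      show "blinfun_apply (f' y) h + 1 / 2 * (blinfun_apply (blinfun_apply (H y) d) h
          + blinfun_apply (blinfun_apply (H y) h) d) + \<omega> / 2 * (d \<bullet> h + h \<bullet> d)
        = blinfun_apply (f' y) h + blinfun_apply (blinfun_apply (H y) d) h + \<omega> * (d \<bullet> h)"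
        unfolding sym[of h d] inner_commute[of h d] by simp
    qed
  qed
  moreover have "\<phi> (y + d) + g (y + d) \<le> \<phi> z + g z" for z
  proof -
    have "step_model f' H g y \<omega> d \<le> step_model f' H g y \<omega> (z - y)"
      unfolding d_def using pos \<omega> by (intro exact_step_minimizes[where H = H and y = y, OF g_lsc g sym lower]) simp
    moreover have "y + d - y = d" "y + (z - y) = z" by simp_all
    ultimately show ?thesis unfolding step_model_def \<phi>_def by simp
  qed
  ultimately have "\<kappa>\<^sub>2 / 2 * (norm (xs - (y + d)))\<^sup>2 \<le> blinfun_apply (f' y) (xs - (y + d))
      + blinfun_apply (blinfun_apply (H y) d) (xs - (y + d)) + \<omega> * (d \<bullet> (xs - (y + d)))
      + g xs - g (y + d)"
    by (rule minimizer_variational_inequality[OF g])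
  moreover have "xs - (y + d) = - e" by (simp add: e_def)
  ultimately have 1: "\<kappa>\<^sub>2 / 2 * (norm e)\<^sup>2 \<le> - blinfun_apply (f' y) e
      - blinfun_apply (blinfun_apply (H y) d) e - \<omega> * (d \<bullet> e) + g xs - g (y + d)"
    by (simp add: blinfun.bilinear_simps)
  have 2: "\<kappa>\<^sub>2 / 2 * (norm e)\<^sup>2 \<le> blinfun_apply (f' xs) e + g (y + d) - g xs"
    using minimizer_variational_inequality[OF g deriv opt, of "y + d"] by (simp add: e_def)
  \<comment> \<open>Adding 1 and 2 cancels the values of \<open>g\<close>. Splitting
    \<open>d = v + e\<close> then leaves \<open>r\<close> applied to \<open>e\<close>, while
    \<open>H y\<close> at \<open>e\<close>, \<open>e\<close> supplies the
    \<open>\<kappa>\<^sub>1\<close> part of \<open>\<kappa>\<close>.\<close>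
  have "blinfun_apply r e = blinfun_apply (f' xs) e - blinfun_apply (f' y) e
      - blinfun_apply (blinfun_apply (H y) v) e"
    by (simp add: r_def blinfun.bilinear_simps)
  moreover have "blinfun_apply (blinfun_apply (H y) d) e
      = blinfun_apply (blinfun_apply (H y) v) e + blinfun_apply (blinfun_apply (H y) e) e"
    by (simp add: dve blinfun.bilinear_simps)
  moreover have "\<kappa> * (norm e)\<^sup>2 = \<kappa>\<^sub>1 * (norm e)\<^sup>2 + \<kappa>\<^sub>2 / 2 * (norm e)\<^sup>2 + \<kappa>\<^sub>2 / 2 * (norm e)\<^sup>2"
    by (simp add: \<kappa>_def algebra_simps)
  moreover have "blinfun_apply r e \<le> norm r * norm e"
    using norm_blinfun[of r e] by simp
  ultimately have key: "\<kappa> * (norm e)\<^sup>2 + \<omega> * (d \<bullet> e) \<le> norm r * norm e"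
    using 1 2 lower[of e] by linarith

  \<comment> \<open>In \<open>key\<close>, the part \<open>\<omega> * (norm e)\<^sup>2\<close> of
    \<open>\<omega> * (d \<bullet> e)\<close> joins \<open>\<kappa>\<close> and creates the
    denominator \<open>\<omega> + \<kappa>\<close>.\<close>
  have e_le: "norm e \<le> \<omega> / (\<omega> + \<kappa>) * norm v + norm r / \<kappa>"
  proof -
    have "d \<bullet> e = v \<bullet> e + (norm e)\<^sup>2" by (simp add: dve inner_simps power2_norm_eq_inner)
    moreover have "- (v \<bullet> e) \<le> norm v * norm e"
      using norm_cauchy_schwarz[of "- v" e] by simp
    then have "\<omega> * - (v \<bullet> e) \<le> \<omega> * (norm v * norm e)" using \<omega> by (rule mult_left_mono)
    ultimately have "(\<omega> + \<kappa>) * norm e * norm e \<le> (\<omega> * norm v + norm r) * norm e"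
      using key by (simp add: algebra_simps power2_eq_square)
    then have "(\<omega> + \<kappa>) * norm e \<le> \<omega> * norm v + norm r"
      using \<omega> by (cases "norm e = 0") (auto simp: mult_le_cancel_right)
    then have "norm e \<le> (\<omega> * norm v + norm r) / (\<omega> + \<kappa>)"
      using \<omega> \<kappa> by (simp add: pos_le_divide_eq mult.commute)
    also have "\<dots> = \<omega> / (\<omega> + \<kappa>) * norm v + norm r / (\<omega> + \<kappa>)"
      by (simp add: add_divide_distrib)
    also have "norm r / (\<omega> + \<kappa>) \<le> norm r / \<kappa>"
      using \<omega> \<kappa> by (intro divide_left_mono) auto
    finally show ?thesis by simp
  qed

  \<comment> \<open>The triangle inequality with \<open>e_le\<close> alone would put
    \<open>1 + \<omega> / (\<omega> + \<kappa>)\<close> before \<open>norm v\<close>. The factor 1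
    is what lets the bound by \<open>\<Theta>\<close> control the contraction.\<close>
  have d_le: "norm d \<le> norm v + norm r / \<kappa>"
  proof (cases "d \<bullet> e \<le> 0") \<comment> \<open>The sign decides whether \<open>d\<close> lies in the ball with diameter \<open>v\<close>.\<close>
    case True
    then have "norm d * norm d \<le> d \<bullet> v"
      by (simp add: dve inner_simps power2_norm_eq_inner flip: power2_eq_square)
    also have "\<dots> \<le> norm v * norm d" using norm_cauchy_schwarz[of d v] by (simp add: mult.commute)
    finally have "norm d \<le> norm v" by (cases "norm d = 0") (auto simp: mult_le_cancel_right)
    moreover have "norm r / \<kappa> \<ge> 0" using \<kappa> by simp
    ultimately show ?thesis by linarith
  next
    case False
    then have "\<omega> * (d \<bullet> e) \<ge> 0" using \<omega> by simp
    then have "\<kappa> * norm e * norm e \<le> norm r * norm e"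
      using key by (simp add: power2_eq_square mult.assoc)
    then have "\<kappa> * norm e \<le> norm r" by (cases "norm e = 0") (auto simp: mult_le_cancel_right)
    then have "norm e \<le> norm r / \<kappa>" using \<kappa> by (simp add: pos_le_divide_eq mult.commute)
    then show ?thesis using norm_triangle_ineq[of v e] by (simp add: dve)
  qed

  have "norm (y + s - xs) \<le> norm e + norm (d - s)"
    using norm_triangle_ineq4[of e "d - s"] by (simp add: e_def algebra_simps)
  also have "norm (d - s) \<le> \<eta> * norm d" using inexact by (simp add: d_def)
  also have "\<eta> * norm d \<le> \<eta> * (norm v + norm r / \<kappa>)" using d_le \<eta> by (rule mult_left_mono)
  finally have "norm (y + s - xs) \<le> (\<omega> / (\<omega> + \<kappa>) + \<eta>) * norm v + (1 + \<eta>) / \<kappa> * norm r"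
    using e_le by (simp add: algebra_simps add_divide_distrib)
  then show ?thesis
    by (simp add: v_def r_def \<kappa>_def norm_minus_commute add.assoc)
qed

section \<open>Orbits of a local contraction\<close>

text \<open>Contraction is assumed only inside the ball, but a contracting step cannot leave it. A
  single entry at \<open>k\<close> therefore propagates by induction, and geometric decay gives the
  limit.\<close>

lemma local_contraction_orbit:
  fixes x :: "nat \<Rightarrow> 'a::real_normed_vector"
  assumes contr: "\<And>j. k1 \<le> j \<Longrightarrow> x j \<in> ball xs \<delta> \<Longrightarrow> norm (x (Suc j) - xs) \<le> q * norm (x j - xs)"
    and q: "0 \<le> q" "q < 1" and k: "k1 \<le> k" "x k \<in> ball xs \<delta>"
  shows "\<forall>j\<ge>k. x j \<in> ball xs \<delta> \<and> norm (x (Suc j) - xs) \<le> q * norm (x j - xs)"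
    and "x \<longlonglongrightarrow> xs"
proof -
  have stay: "x j \<in> ball xs \<delta>" if "j \<ge> k" for j
    using that
  proof (induction j rule: dec_induct)
    case base
    show ?case by (rule k)
  next
    case (step j)
    have "norm (x (Suc j) - xs) \<le> q * norm (x j - xs)" using contr step k by simp
    also have "\<dots> \<le> norm (x j - xs)" using q by (simp add: mult_left_le_one_le)
    finally show ?case using step.IH by (simp add: dist_norm norm_minus_commute)
  qed
  then show *: "\<forall>j\<ge>k. x j \<in> ball xs \<delta> \<and> norm (x (Suc j) - xs) \<le> q * norm (x j - xs)"
    using contr k by simp
  have bound: "norm (x (n + k) - xs) \<le> q ^ n * norm (x k - xs)" for n
  proof (induction n)
    case (Suc n)
    have "norm (x (Suc n + k) - xs) \<le> q * norm (x (n + k) - xs)" using * by simp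
    also have "\<dots> \<le> q * (q ^ n * norm (x k - xs))" using Suc q by (intro mult_left_mono)
    finally show ?case by (simp add: mult.assoc)
  qed simp
  have "(\<lambda>n. q ^ n * norm (x k - xs)) \<longlonglongrightarrow> 0"
    using q by (intro tendsto_mult_left_zero LIMSEQ_realpow_zero)
  then have "(\<lambda>n. x (n + k) - xs) \<longlonglongrightarrow> 0"
    by (rule Lim_null_comparison[OF always_eventually[OF allI[OF bound]]])
  then have "(\<lambda>n. x (n + k)) \<longlonglongrightarrow> xs" by (rule LIM_zero_cancel)
  then show "x \<longlonglongrightarrow> xs" by (rule LIMSEQ_offset)
qed

section \<open>Linear and superlinear rates\<close>

theorem theorem3p2:
  fixes f g :: "'a::{real_inner,complete_space} \<Rightarrow> real"
    and f' :: "'a \<Rightarrow> 'a \<Rightarrow>\<^sub>L real"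
    and H :: "'a \<Rightarrow> 'a \<Rightarrow>\<^sub>L ('a \<Rightarrow>\<^sub>L real)"
    and \<kappa>\<^sub>1 \<kappa>\<^sub>2 L\<^sub>f M :: real
    and xs :: 'a
    and x s :: "nat \<Rightarrow> 'a"
    and \<omega> \<eta> :: "nat \<Rightarrow> real"
  assumes f_deriv: "\<And>y. (f has_derivative blinfun_apply (f' y)) (at y)"
    and f'_cont: "continuous_on UNIV f'"
    and f'_lipschitz: "L\<^sub>f > 0" "L\<^sub>f-lipschitz_on UNIV f'"
    and g_lsc: "lower_semicontinuous g"
    and g_convex: "convex_with_modulus \<kappa>\<^sub>2 g"
    and H_sym: "\<And>y v w. blinfun_apply (blinfun_apply (H y) v) w
                         = blinfun_apply (blinfun_apply (H y) w) v"
    and H_lower: "\<forall>\<^sub>F y in nhds xs. \<forall>v. blinfun_apply (blinfun_apply (H y) v) v \<ge> \<kappa>\<^sub>1 * (norm v)\<^sup>2"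
    and \<kappa>_pos: "\<kappa>\<^sub>1 + \<kappa>\<^sub>2 > 0"
    and optimal: "is_arg_min (\<lambda>y. f y + g y) (\<lambda>_. True) xs"
    and semismooth: "semismooth_at f' H xs"
    and H_bound: "M > 0" "\<And>k. norm (H (x k)) \<le> M"
    and \<omega>_nonneg: "\<And>k. \<omega> k \<ge> 0"
    and \<eta>_nonneg: "\<And>k. \<eta> k \<ge> 0"
    and iterates: "\<And>k. x (Suc k) = x k + s k"
    and inexact: "\<And>k. norm (exact_step f' H g (x k) (\<omega> k) - s k)
                       \<le> \<eta> k * norm (exact_step f' H g (x k) (\<omega> k))"
  shows "((\<exists>\<Theta> k0. 0 < \<Theta> \<and> \<Theta> < 1 \<and>
             (\<forall>k\<ge>k0. 1 / (\<omega> k + \<kappa>\<^sub>1 + \<kappa>\<^sub>2)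
                        * ((\<omega> k + norm (H (x k)) + \<kappa>\<^sub>2) * \<eta> k + \<omega> k) < \<Theta>))
           \<longrightarrow> locally_converges_linearly x xs)
       \<and> (\<omega> \<longlonglongrightarrow> 0 \<and> \<eta> \<longlonglongrightarrow> 0 \<longrightarrow> locally_converges_superlinearly x xs)"
proof -
  define \<kappa> where "\<kappa> = \<kappa>\<^sub>1 + \<kappa>\<^sub>2"
  have \<kappa>: "\<kappa> > 0" using \<kappa>_pos by (simp add: \<kappa>_def)
  define r where "r = (\<lambda>y. norm (f' xs - f' y - blinfun_apply (H y) (xs - y)))"
  have opt: "f xs + g xs \<le> f z + g z" for z
    using optimal by (simp add: is_arg_min_def not_less)
  obtain \<delta>0 where \<delta>0: "\<delta>0 > 0"
    "\<And>y v. dist y xs < \<delta>0 \<Longrightarrow> \<kappa>\<^sub>1 * (norm v)\<^sup>2 \<le> blinfun_apply (blinfun_apply (H y) v) v"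
    using H_lower by (auto simp: eventually_nhds_metric)
  have step: "norm (x (Suc k) - xs) \<le> (\<omega> k / (\<omega> k + \<kappa>) + \<eta> k) * norm (x k - xs)
      + (1 + \<eta> k) / \<kappa> * r (x k)" if "dist (x k) xs < \<delta>0" for k
    using inexact_step_estimate[where H = H and y = "x k" and s = "s k" and f' = f' and xs = xs and g = g
        and \<omega> = "\<omega> k" and \<eta> = "\<eta> k" and f = f, OF f_deriv g_lsc g_convex opt H_sym \<delta>0(2)[OF that] \<kappa>_pos
        \<omega>_nonneg \<eta>_nonneg inexact]
    by (simp add: iterates r_def \<kappa>_def add.assoc)
  have residual: "\<exists>\<delta>>0. \<delta> \<le> \<delta>0 \<and> (\<forall>y. dist y xs < \<delta> \<longrightarrow> r y \<le> c * norm (y - xs))" if "c > 0" for c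
  proof -
    have "\<forall>\<^sub>F y in at xs. r y \<le> c * norm (y - xs)"
      using landau_o.smallD[OF semismooth[unfolded semismooth_at_def] that] by (simp add: r_def)
    then obtain \<delta> where \<delta>: "\<delta> > 0" "\<And>y. y \<noteq> xs \<Longrightarrow> dist y xs < \<delta> \<Longrightarrow> r y \<le> c * norm (y - xs)"
      by (auto simp: eventually_at)
    \<comment> \<open>Semismoothness concerns the punctured neighbourhood; at \<open>xs\<close>
      itself the residual vanishes.\<close>
    have "r xs \<le> c * norm (xs - xs)" by (simp add: r_def)
    with \<delta> \<delta>0(1) show ?thesis by (intro exI[of _ "min \<delta> \<delta>0"]) (metis min.cobounded2 min_less_iff_conj)
  qed
  have estimate: "\<exists>\<delta>>0. \<delta> \<le> \<delta>0 \<and> (\<forall>k. x k \<in> ball xs \<delta> \<longrightarrow> \<eta> k \<le> 1 \<longrightarrow>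
      norm (x (Suc k) - xs) \<le> (\<omega> k / (\<omega> k + \<kappa>) + \<eta> k + c) * norm (x k - xs))" if "c > 0" for c
  proof -
    \<comment> \<open>For \<open>\<eta> k \<le> 1\<close> the residual is multiplied by at most
      \<open>2 / \<kappa>\<close>, so the tolerance \<open>c * \<kappa> / 2\<close> costs exactly
      \<open>c\<close>.\<close>
    obtain \<delta> where \<delta>: "\<delta> > 0" "\<delta> \<le> \<delta>0" "\<And>y. dist y xs < \<delta> \<Longrightarrow> r y \<le> c * \<kappa> / 2 * norm (y - xs)"
      using residual[of "c * \<kappa> / 2"] \<open>c > 0\<close> \<kappa> by auto
    have "norm (x (Suc k) - xs) \<le> (\<omega> k / (\<omega> k + \<kappa>) + \<eta> k + c) * norm (x k - xs)"
      if k: "x k \<in> ball xs \<delta>" "\<eta> k \<le> 1" for k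
    proof -
      have dk: "dist (x k) xs < \<delta>" using k by (simp add: dist_commute)
      have "(1 + \<eta> k) / \<kappa> * r (x k) \<le> 2 / \<kappa> * (c * \<kappa> / 2 * norm (x k - xs))"
        using k \<kappa> \<delta>(3)[OF dk] \<open>c > 0\<close> by (intro mult_mono divide_right_mono) (auto simp: r_def)
      also have "\<dots> = c * norm (x k - xs)" using \<kappa> by simp
      finally show ?thesis using step[of k] dk \<delta>(2) by (simp add: algebra_simps)
    qed
    with \<delta> show ?thesis by blast
  qed
  show ?thesis
  proof (intro conjI impI)
    assume "\<exists>\<Theta> k0. 0 < \<Theta> \<and> \<Theta> < 1 \<and> (\<forall>k\<ge>k0. 1 / (\<omega> k + \<kappa>\<^sub>1 + \<kappa>\<^sub>2)
        * ((\<omega> k + norm (H (x k)) + \<kappa>\<^sub>2) * \<eta> k + \<omega> k) < \<Theta>)"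
    then obtain \<Theta> k0 where \<Theta>: "0 < \<Theta>" "\<Theta> < 1"
      "\<And>k. k \<ge> k0 \<Longrightarrow> 1 / (\<omega> k + \<kappa>) * ((\<omega> k + norm (H (x k)) + \<kappa>\<^sub>2) * \<eta> k + \<omega> k) < \<Theta>"
      by (auto simp: \<kappa>_def add.assoc)
    \<comment> \<open>Half of the gap between \<open>\<Theta>\<close> and 1 pays for the residual;
      the other half keeps \<open>q\<close> below 1.\<close>
    obtain \<delta> where \<delta>: "\<delta> > 0" "\<delta> \<le> \<delta>0" "\<And>k. x k \<in> ball xs \<delta> \<Longrightarrow> \<eta> k \<le> 1 \<Longrightarrow>
      norm (x (Suc k) - xs) \<le> (\<omega> k / (\<omega> k + \<kappa>) + \<eta> k + (1 - \<Theta>) / 2) * norm (x k - xs)"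
      using estimate[of "(1 - \<Theta>) / 2"] \<Theta> by auto
    define q where "q = \<Theta> + (1 - \<Theta>) / 2"
    have q: "0 < q" "q < 1" using \<Theta> by (auto simp: q_def field_simps)
    have contr: "norm (x (Suc k) - xs) \<le> q * norm (x k - xs)" if k: "k0 \<le> k" "x k \<in> ball xs \<delta>" for k
    proof -
      have dk: "dist (x k) xs < \<delta>0" using k(2) \<delta>(2) by (simp add: dist_commute)
      show ?thesis
      proof (cases "\<exists>v::'a. v \<noteq> 0") \<comment> \<open>On the zero space the norm of \<open>H\<close> is \<open>0\<close> and may lie below \<open>\<kappa>\<^sub>1\<close>.\<close>
        case False
        then have "x (Suc k) = xs" "x k = xs" by (metis right_minus_eq)+
        then show ?thesis by simp
      next
        case True
        then obtain v :: 'a where v: "v \<noteq> 0" by blast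
        \<comment> \<open>Testing the lower bound on a nonzero vector compares
          \<open>\<kappa>\<^sub>1\<close> with the operator norm, so that
          \<open>(\<omega> k + \<kappa>) * \<eta> k\<close> can replace the term in the
          hypothesis.\<close>
        have "\<kappa>\<^sub>1 * (norm v)\<^sup>2 \<le> norm (blinfun_apply (H (x k)) v) * norm v"
          using \<delta>0(2)[OF dk, of v] norm_blinfun[of "blinfun_apply (H (x k)) v" v] by simp
        also have "\<dots> \<le> norm (H (x k)) * norm v * norm v"
          by (intro mult_right_mono norm_blinfun) auto
        finally have "\<kappa>\<^sub>1 \<le> norm (H (x k))" using v by (simp add: power2_eq_square)
        then have "(\<omega> k + \<kappa>) * \<eta> k \<le> (\<omega> k + norm (H (x k)) + \<kappa>\<^sub>2) * \<eta> k"
          using \<eta>_nonneg by (intro mult_right_mono) (auto simp: \<kappa>_def)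
        moreover have pos: "\<omega> k + \<kappa> > 0" using \<omega>_nonneg[of k] \<kappa> by simp
        moreover have "(\<omega> k + norm (H (x k)) + \<kappa>\<^sub>2) * \<eta> k + \<omega> k < \<Theta> * (\<omega> k + \<kappa>)"
          using \<Theta>(3)[OF k(1)] pos by (simp add: pos_divide_less_eq)
        ultimately have "(\<omega> k + \<kappa>) * \<eta> k + \<omega> k < \<Theta> * (\<omega> k + \<kappa>)" by linarith
        then have "((\<omega> k + \<kappa>) * \<eta> k + \<omega> k) / (\<omega> k + \<kappa>) < \<Theta>"
          using pos by (simp add: pos_divide_less_eq)
        then have le: "\<omega> k / (\<omega> k + \<kappa>) + \<eta> k < \<Theta>" using pos by (simp add: add_divide_distrib)
        moreover have "\<omega> k / (\<omega> k + \<kappa>) \<ge> 0" using pos \<omega>_nonneg[of k] by simp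
        \<comment> \<open>The smallness of \<open>\<eta> k\<close> that \<open>estimate\<close>
          demands follows from the bound by \<open>\<Theta>\<close>.\<close>
        ultimately have "\<eta> k \<le> 1" using \<Theta> by linarith
        note \<delta>(3)[OF k(2) this]
        also have "(\<omega> k / (\<omega> k + \<kappa>) + \<eta> k + (1 - \<Theta>) / 2) * norm (x k - xs) \<le> q * norm (x k - xs)"
          using le by (intro mult_right_mono) (auto simp: q_def)
        finally show ?thesis .
      qed
    qed
    show "locally_converges_linearly x xs"
      unfolding locally_converges_linearly_def
    proof (intro exI[of _ "ball xs \<delta>"] exI[of _ k0] conjI allI impI)
      fix k assume k: "k0 \<le> k" "x k \<in> ball xs \<delta>"
      note orbit = local_contraction_orbit[of k0 x xs \<delta> q k, OF contr _ q(2) k]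
      show "x \<longlonglongrightarrow> xs" using orbit(2) q by simp
      show "\<exists>q. 0 < q \<and> q < 1 \<and> (\<forall>j\<ge>k. norm (x (Suc j) - xs) \<le> q * norm (x j - xs))"
        using orbit(1) q by (intro exI[of _ q]) auto
    qed (use \<delta> in auto)
  next
    assume "\<omega> \<longlonglongrightarrow> 0 \<and> \<eta> \<longlonglongrightarrow> 0"
    then have lim: "\<omega> \<longlonglongrightarrow> 0" "\<eta> \<longlonglongrightarrow> 0" by auto
    have "(\<lambda>k. \<omega> k / (\<omega> k + \<kappa>) + \<eta> k) \<longlonglongrightarrow> 0 / (0 + \<kappa>) + 0"
      using \<kappa> by (intro tendsto_intros lim) auto
    then have coef: "\<forall>\<^sub>F k in sequentially. \<omega> k / (\<omega> k + \<kappa>) + \<eta> k < c" if "c > 0" for c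
      using that by (auto dest: order_tendstoD(2)[where a = c])
    have \<eta>1: "\<forall>\<^sub>F k in sequentially. \<eta> k < 1"
      using lim(2) by (auto dest: order_tendstoD(2)[where a = 1])
    \<comment> \<open>A quarter for the coefficients and a quarter for the residual give the fixed
      rate 1/2.\<close>
    obtain k1 where k1: "\<And>k. k \<ge> k1 \<Longrightarrow> \<omega> k / (\<omega> k + \<kappa>) + \<eta> k < 1 / 4 \<and> \<eta> k < 1"
      using eventually_conj[OF coef[of "1/4"] \<eta>1] by (auto simp: eventually_sequentially)
    obtain \<delta> where \<delta>: "\<delta> > 0" "\<And>k. x k \<in> ball xs \<delta> \<Longrightarrow> \<eta> k \<le> 1 \<Longrightarrow>
      norm (x (Suc k) - xs) \<le> (\<omega> k / (\<omega> k + \<kappa>) + \<eta> k + 1 / 4) * norm (x k - xs)"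
      using estimate[of "1 / 4"] by auto
    have contr: "norm (x (Suc k) - xs) \<le> 1 / 2 * norm (x k - xs)" if k: "k1 \<le> k" "x k \<in> ball xs \<delta>" for k
    proof -
      have "norm (x (Suc k) - xs) \<le> (\<omega> k / (\<omega> k + \<kappa>) + \<eta> k + 1 / 4) * norm (x k - xs)"
        using \<delta>(2)[OF k(2)] k1[OF k(1)] by simp
      also have "\<dots> \<le> 1 / 2 * norm (x k - xs)"
        using k1[OF k(1)] by (intro mult_right_mono norm_ge_zero) linarith
      finally show ?thesis .
    qed
    show "locally_converges_superlinearly x xs"
      unfolding locally_converges_superlinearly_def
    proof (intro exI[of _ "ball xs \<delta>"] exI[of _ k1] conjI allI impI)
      fix k assume k: "k1 \<le> k" "x k \<in> ball xs \<delta>"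
      \<comment> \<open>Convergence at the fixed rate comes first: it brings the tail into the
        smaller balls used for the little-o bound.\<close>
      show conv: "x \<longlonglongrightarrow> xs"
        using local_contraction_orbit(2)[of k1 x xs \<delta> "1/2" k, OF contr _ _ k] by simp
      show "(\<lambda>j. norm (x (Suc j) - xs)) \<in> o(\<lambda>j. norm (x j - xs))"
      proof (rule landau_o.smallI)
        fix c :: real assume c: "c > 0"
        \<comment> \<open>Each \<open>c\<close> gets its own radius; the residual and the
          coefficients each take \<open>c / 2\<close>.\<close>
        obtain \<delta>' where \<delta>': "\<delta>' > 0" "\<And>k. x k \<in> ball xs \<delta>' \<Longrightarrow> \<eta> k \<le> 1 \<Longrightarrow>
          norm (x (Suc k) - xs) \<le> (\<omega> k / (\<omega> k + \<kappa>) + \<eta> k + c / 2) * norm (x k - xs)"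
          using estimate[of "c / 2"] c by auto
        have "\<forall>\<^sub>F j in sequentially. x j \<in> ball xs \<delta>'"
          using conv \<delta>'(1) by (simp add: tendsto_iff dist_commute)
        moreover have "\<forall>\<^sub>F j in sequentially. \<omega> j / (\<omega> j + \<kappa>) + \<eta> j < c / 2"
          using coef[of "c / 2"] c by simp
        ultimately show "\<forall>\<^sub>F j in sequentially. norm (norm (x (Suc j) - xs)) \<le> c * norm (norm (x j - xs))"
          using \<eta>1
        proof eventually_elim
          case (elim j)
          then have "norm (x (Suc j) - xs) \<le> (\<omega> j / (\<omega> j + \<kappa>) + \<eta> j + c / 2) * norm (x j - xs)"
            using \<delta>'(2) by simp
          also have "\<dots> \<le> c * norm (x j - xs)"
            using elim by (intro mult_right_mono norm_ge_zero) linarith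
          finally show ?case by simp
        qed
      qed
    qed (use \<delta> in auto)
  qed
qed

end
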